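(* Let $m,n \in \mathbb{Z}^+$. If there is a primefree $\mathrm{CK}(n,m)$-domain, then $m \leq \frac{n}{3}$.
   Context: A domain is a commutative ring (with $1 \neq 0$) without zero-divisors. For a domain $R$, let $R^{\times}$ be its unit group and $R^{\circ} = R \setminus (\{0\} \cup R^{\times})$. An element $p \in R^{\circ}$ is prime if the ideal $(p)$ is prime; $p \in R^{\circ}$ is an atom if for all $x,y \in R$, $p = xy$ implies $x \in R^{\times}$ or $y \in R^{\times}$. $R$ is atomic if every $x \in R^{\circ}$ is a finite product of atoms. $R$ is primefree if it has no prime elements. "$R$ has $\kappa$ atoms" means there is a set $\mathcal{P}$ of atoms of $R$ of cardinality $\kappa$ such that every atom of $R$ is associate to a unique $p \in \mathcal{P}$. For $m,n \in \mathbb{Z}^+$, a $\mathrm{CK}(n,m)$-domain is an atomic domain with exactly $n$ atoms and exactly $m$ maximal ideals. *)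

theory Defs
  imports "HOL-Algebra.Algebra"
begin

definition nonzero_nonunits :: "('a, 'b) ring_scheme \<Rightarrow> 'a set"
  where "nonzero_nonunits R = carrier R - ({\<zero>\<^bsub>R\<^esub>} \<union> Units R)"

definition prime_elements :: "('a, 'b) ring_scheme \<Rightarrow> 'a set"
  where "prime_elements R = {p \<in> nonzero_nonunits R. primeideal (PIdl\<^bsub>R\<^esub> p) R}"

definition atoms :: "('a, 'b) ring_scheme \<Rightarrow> 'a set"
  where "atoms R = {p \<in> nonzero_nonunits R.
    \<forall>x\<in>carrier R. \<forall>y\<in>carrier R. p = x \<otimes>\<^bsub>R\<^esub> y \<longrightarrow> x \<in> Units R \<or> y \<in> Units R}"

definition atomic_domain :: "('a, 'b) ring_scheme \<Rightarrow> bool"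
  where "atomic_domain R \<longleftrightarrow> domain R \<and>
    (\<forall>x\<in>nonzero_nonunits R. \<exists>ps. set ps \<subseteq> atoms R \<and> foldr (\<otimes>\<^bsub>R\<^esub>) ps \<one>\<^bsub>R\<^esub> = x)"

definition primefree :: "('a, 'b) ring_scheme \<Rightarrow> bool"
  where "primefree R \<longleftrightarrow> prime_elements R = {}"

definition has_n_atoms :: "('a, 'b) ring_scheme \<Rightarrow> nat \<Rightarrow> bool"
  where "has_n_atoms R n \<longleftrightarrow> (\<exists>P. P \<subseteq> atoms R \<and> finite P \<and> card P = n \<and>
    (\<forall>a\<in>atoms R. \<exists>!p. p \<in> P \<and> a \<sim>\<^bsub>R\<^esub> p))"

definition has_n_maximal_ideals :: "('a, 'b) ring_scheme \<Rightarrow> nat \<Rightarrow> bool"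
  where "has_n_maximal_ideals R m \<longleftrightarrow>
    finite {M. maximalideal M R} \<and> card {M. maximalideal M R} = m"

definition CK_domain :: "nat \<Rightarrow> nat \<Rightarrow> ('a, 'b) ring_scheme \<Rightarrow> bool"
  where "CK_domain n m R \<longleftrightarrow>
    atomic_domain R \<and> has_n_atoms R n \<and> has_n_maximal_ideals R m"

text \<open>In a domain the element notions above agree with those of the library,
  which carry no carrier condition.\<close>

lemma (in domain) prime_elements_eq: "prime_elements R = {p \<in> carrier R. ring_prime p}"
proof -
  have "p \<notin> Units R" if "ring_prime p" for p
    using that by (simp add: ring_prime_def prime_def)
  moreover have "p \<noteq> \<zero>" if "ring_prime p" for p
    using that by (simp add: ring_prime_def)
  ultimately show ?thesis
    unfolding prime_elements_def nonzero_nonunits_def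
    using primeideal_iff_prime by auto
qed

lemma (in domain) atoms_eq: "atoms R = {p \<in> carrier R. ring_irreducible p}"
proof (rule Set.set_eqI, rule iffI)
  fix p assume "p \<in> atoms R"
  then show "p \<in> {p \<in> carrier R. ring_irreducible p}"
    by (auto simp: atoms_def nonzero_nonunits_def intro!: ring_irreducibleI)
next
  fix p assume "p \<in> {p \<in> carrier R. ring_irreducible p}"
  then have p: "p \<in> carrier R" "ring_irreducible p" by auto
  show "p \<in> atoms R"
    using p ring_irreducibleE[OF p] by (auto simp: atoms_def nonzero_nonunits_def)
qed

end

theory Submission
  imports Defs
begin

text \<open>
  Every maximal ideal contains at least three atoms: if it contained only one up to associates,
  that atom would be prime, and if it contained only \<open>p\<close> and \<open>q\<close>, one of them would divide
  \<open>p + q\<close> and hence the other. It remains to see that no atom \<open>p\<close> lies in two maximal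
  ideals. Up to units the nonzero elements form a finitely generated monoid, so by Dickson's lemma
  every sequence of them contains a term dividing a later one. Applied to \<open>p + j\<^sup>k\<close> this shows
  that every element \<open>j\<close> of the Jacobson radical has a power divisible by \<open>p\<close>; no
  localization or dimension theory is needed. Hence two distinct maximal ideals containing \<open>p\<close>
  can be separated by elements that are idempotent modulo \<open>p\<close>, and these split \<open>p\<close> into
  two nonunits.
\<close>

section \<open>Dickson's lemma for exponent vectors\<close>

text \<open>A monotone subsequence always exists; if it decreases, it is constant from the index of
  its least value on, so a tail of it serves.\<close>

lemma nat_seq_mono_subseq:
  fixes s :: "nat \<Rightarrow> nat"
  shows "\<exists>f::nat \<Rightarrow> nat. strict_mono f \<and> mono (\<lambda>k. s (f k))"
proof -
  obtain f where f: "strict_mono f" "monoseq (\<lambda>k. s (f k))"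
    using seq_monosub by blast
  show ?thesis
  proof (cases "mono (\<lambda>k. s (f k))")
    case True
    then show ?thesis using f by blast
  next
    case False
    then have dec: "s (f l) \<le> s (f k)" if "k \<le> l" for k l
      using f(2) that by (auto simp: monoseq_def mono_def)
    obtain N where N: "\<And>k. s (f N) \<le> s (f k)"
      using ex_has_least_nat[of "\<lambda>_. True" 0 "\<lambda>k. s (f k)"] by auto
    have "s (f (N + k)) = s (f N)" for k
      using dec[of N "N + k"] N[of "N + k"] by simp
    moreover have "strict_mono (\<lambda>k. f (N + k))"
      using f(1) by (simp add: strict_mono_def)
    ultimately show ?thesis
      by (intro exI[of _ "\<lambda>k. f (N + k)"]) (simp add: mono_def)
  qed
qed

text \<open>Subsequences are extracted one coordinate at a time; passing to a further subsequence
  keeps the coordinates already treated monotone.\<close>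

lemma dickson_subseq:
  fixes e :: "nat \<Rightarrow> 'a \<Rightarrow> nat"
  assumes "finite P"
  shows "\<exists>f::nat \<Rightarrow> nat. strict_mono f \<and> (\<forall>p\<in>P. mono (\<lambda>k. e (f k) p))"
  using assms
proof (induction P rule: finite_induct)
  case empty
  then show ?case using strict_mono_id by blast
next
  case (insert p P)
  then obtain f :: "nat \<Rightarrow> nat" where f: "strict_mono f" "\<forall>p\<in>P. mono (\<lambda>k. e (f k) p)" by blast
  obtain g :: "nat \<Rightarrow> nat" where g: "strict_mono g" "mono (\<lambda>k. e (f (g k)) p)"
    using nat_seq_mono_subseq[of "\<lambda>k. e (f k) p"] by blast
  have "mono (\<lambda>k. e (f (g k)) q)" if "q \<in> P" for q
    using f(2) that strict_mono_mono[OF g(1)] by (simp add: mono_def)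
  then show ?case
    using f(1) g by (intro exI[of _ "\<lambda>k. f (g k)"]) (auto simp: strict_mono_def)
qed

section \<open>Maximal ideals and units\<close>

text \<open>Zorn's lemma applies because properness of an ideal means avoiding
  \<open>\<one>\<close>, a condition that survives unions of chains.\<close>

lemma (in ring) exists_maximalideal:
  assumes "ideal I R" "I \<noteq> carrier R"
  obtains M where "maximalideal M R" "I \<subseteq> M"
proof -
  define A where "A = {J. ideal J R \<and> I \<subseteq> J \<and> \<one> \<notin> J}"
  have "\<one> \<notin> I"
    using assms ideal.one_imp_carrier by blast
  then have "A \<noteq> {}"
    using assms(1) by (auto simp: A_def)
  moreover have "\<Union>C \<in> A" if C: "C \<noteq> {}" "subset.chain A C" for C
  proof -
    have "subset.chain {J. ideal J R} C"
      using C(2) by (auto simp: pred_on.chain_def A_def)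
    then have "ideal (\<Union>C) R"
      using chain_Union_is_ideal[of C] C(1) by simp
    then show ?thesis
      using C by (auto simp: pred_on.chain_def A_def)
  qed
  ultimately obtain M where M: "M \<in> A" "\<And>J. J \<in> A \<Longrightarrow> M \<subseteq> J \<Longrightarrow> J = M"
    using subset_Zorn_nonempty[of A] by blast
  have "maximalideal M R"
  proof (rule maximalidealI)
    show "ideal M R" using M(1) by (simp add: A_def)
    show "carrier R \<noteq> M" using M(1) by (auto simp: A_def)
    fix J assume J: "ideal J R" "M \<subseteq> J" "J \<subseteq> carrier R"
    show "J = M \<or> J = carrier R"
    proof (cases "\<one> \<in> J")
      case True
      then show ?thesis using ideal.one_imp_carrier[OF J(1)] by blast
    next
      case False
      then have "J \<in> A" using J M(1) by (auto simp: A_def)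
      then show ?thesis using M(2) J(2) by blast
    qed
  qed
  then show ?thesis
    using that M(1) by (auto simp: A_def)
qed

lemma (in cring) Units_iff_notin_maximalideals:
  assumes "x \<in> carrier R"
  shows "x \<in> Units R \<longleftrightarrow> (\<forall>M. maximalideal M R \<longrightarrow> x \<notin> M)"
proof
  assume x: "x \<in> Units R"
  show "\<forall>M. maximalideal M R \<longrightarrow> x \<notin> M"
  proof (intro allI impI notI)
    fix M assume M: "maximalideal M R" "x \<in> M"
    interpret M: maximalideal M R by fact
    have "inv x \<otimes> x \<in> M"
      using M(2) x by (intro M.I_l_closed) auto
    then show False
      using x M.one_imp_carrier M.I_notcarr by simp
  qed
next
  assume *: "\<forall>M. maximalideal M R \<longrightarrow> x \<notin> M"
  have "PIdl x = carrier R"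
    using exists_maximalideal[of "PIdl x"] cgenideal_ideal[OF assms] cgenideal_self[OF assms] *
    by blast
  then obtain y where "y \<in> carrier R" "\<one> = y \<otimes> x"
    using one_closed unfolding cgenideal_def by blast
  then show "x \<in> Units R"
    using assms m_comm unfolding Units_def by auto
qed

section \<open>Comaximal elements and ideals\<close>

definition comaximal :: "('a, 'b) ring_scheme \<Rightarrow> 'a \<Rightarrow> 'a \<Rightarrow> bool"
  where "comaximal R x y \<longleftrightarrow>
    (\<exists>u\<in>carrier R. \<exists>v\<in>carrier R. x \<otimes>\<^bsub>R\<^esub> u \<oplus>\<^bsub>R\<^esub> y \<otimes>\<^bsub>R\<^esub> v = \<one>\<^bsub>R\<^esub>)"

context cring
begin

lemma comaximal_sym:
  assumes "x \<in> carrier R" "y \<in> carrier R" "comaximal R x y"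
  shows "comaximal R y x"
  using assms unfolding comaximal_def by (metis a_comm m_closed)

text \<open>In the product of the two Bezout relations every term except
  \<open>(y \<otimes> z) \<otimes> (v \<otimes> v')\<close> contains the factor
  \<open>x\<close>.\<close>

lemma comaximal_mult:
  assumes c: "x \<in> carrier R" "y \<in> carrier R" "z \<in> carrier R"
    and "comaximal R x y" "comaximal R x z"
  shows "comaximal R x (y \<otimes> z)"
proof -
  obtain u v where 1: "u \<in> carrier R" "v \<in> carrier R" "x \<otimes> u \<oplus> y \<otimes> v = \<one>"
    using assms(4) by (auto simp: comaximal_def)
  obtain u' v' where 2: "u' \<in> carrier R" "v' \<in> carrier R" "x \<otimes> u' \<oplus> z \<otimes> v' = \<one>"
    using assms(5) by (auto simp: comaximal_def)
  have "\<one> = (x \<otimes> u \<oplus> y \<otimes> v) \<otimes> (x \<otimes> u' \<oplus> z \<otimes> v')"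
    using 1(3) 2(3) by simp
  also have "\<dots> = x \<otimes> (u \<otimes> (x \<otimes> u' \<oplus> z \<otimes> v') \<oplus> y \<otimes> v \<otimes> u') \<oplus> (y \<otimes> z) \<otimes> (v \<otimes> v')"
    using c 1(1,2) 2(1,2) by algebra
  finally show ?thesis
    using c 1(1,2) 2(1,2) unfolding comaximal_def
    by (metis a_closed m_closed)
qed

lemma comaximal_pow:
  assumes "x \<in> carrier R" "y \<in> carrier R" "comaximal R x y"
  shows "comaximal R x (y [^] (k::nat))"
proof (induction k)
  case 0
  have "x \<otimes> \<zero> \<oplus> \<one> \<otimes> \<one> = \<one>" using assms by simp
  then show ?case unfolding comaximal_def nat_pow_0 by blast
next
  case (Suc k)
  then show ?case using assms by (simp add: comaximal_mult)
qed

lemma comaximal_pow_pow: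
  assumes "x \<in> carrier R" "y \<in> carrier R" "comaximal R x y"
  shows "comaximal R (x [^] (k::nat)) (y [^] (l::nat))"
  using assms by (metis comaximal_pow comaximal_sym nat_pow_closed)

lemma maximalideals_comaximal:
  assumes M: "maximalideal M R" and N: "maximalideal N R" and "M \<noteq> N"
  shows "\<exists>x\<in>M. \<exists>y\<in>N. x \<oplus> y = \<one>"
proof -
  interpret M: maximalideal M R by fact
  interpret N: maximalideal N R by fact
  have MN: "ideal (set_add R M N) R"
    using add_ideals[OF M.is_ideal N.is_ideal] .
  have sub: "M \<subseteq> set_add R M N" "N \<subseteq> set_add R M N"
    using genideal_self union_genideal[OF M.is_ideal N.is_ideal] M.a_subset N.a_subset
    by (metis Un_subset_iff)+
  have "set_add R M N = carrier R"
    using M.I_maximal[OF MN sub(1)] N.I_maximal[OF MN sub(2)] \<open>M \<noteq> N\<close>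
      ideal.Icarr[OF MN] by blast
  then have "\<one> \<in> set_add R M N" by simp
  then show ?thesis by (force simp: set_add_def')
qed

text \<open>For \<open>F\<close> the set of all other maximal ideals, this yields an element
  \<open>b\<close> of each of them that is \<open>\<one>\<close> modulo \<open>M\<close>.\<close>

lemma comaximal_maximalideals:
  assumes M: "maximalideal M R" and "finite F"
    and "\<And>N. N \<in> F \<Longrightarrow> maximalideal N R \<and> N \<noteq> M"
  shows "\<exists>a\<in>M. \<exists>b\<in>carrier R. (\<forall>N\<in>F. b \<in> N) \<and> a \<oplus> b = \<one>"
  using assms(2,3)
proof (induction F rule: finite_induct)
  case empty
  interpret M: maximalideal M R by fact
  show ?case by (intro bexI[of _ \<zero>] bexI[of _ \<one>]) auto
next
  case (insert N F)
  interpret M: maximalideal M R by fact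
  interpret N: maximalideal N R using insert by blast
  obtain a b where ab: "a \<in> M" "b \<in> carrier R" "\<forall>N\<in>F. b \<in> N" "a \<oplus> b = \<one>"
    using insert by blast
  obtain c d where cd: "c \<in> M" "d \<in> N" "c \<oplus> d = \<one>"
    using maximalideals_comaximal[OF M N.maximalideal_axioms] insert.prems by blast
  have car: "a \<in> carrier R" "c \<in> carrier R" "d \<in> carrier R"
    using ab cd by auto
  \<comment> \<open>Expanding the product of the two relations, everything but
    \<open>b \<otimes> d\<close> contains \<open>a\<close> or \<open>c\<close> and so lies in
    \<open>M\<close>.\<close>
  have "(a \<otimes> (c \<oplus> d) \<oplus> b \<otimes> c) \<oplus> b \<otimes> d = (a \<oplus> b) \<otimes> (c \<oplus> d)"
    using car ab(2) by algebra
  then have "(a \<otimes> (c \<oplus> d) \<oplus> b \<otimes> c) \<oplus> b \<otimes> d = \<one>"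
    using ab(4) cd(3) by simp
  moreover have "a \<otimes> (c \<oplus> d) \<oplus> b \<otimes> c \<in> M"
    using ab cd car by (intro M.a_closed M.I_r_closed M.I_l_closed) auto
  moreover have "b \<otimes> d \<in> K" if "K \<in> insert N F" for K
  proof (cases "K = N")
    case True
    then show ?thesis using ab(2) cd(2) N.I_l_closed by simp
  next
    case False
    then interpret K: maximalideal K R using that insert.prems by simp
    show ?thesis using False that ab(3) car K.I_r_closed by simp
  qed
  ultimately show ?case
    using ab(2) car m_closed[of b d] by blast
qed

end

section \<open>Factorization over finitely many atoms\<close>

locale finite_atomic_domain = domain +
  fixes P
  assumes atomic: "atomic_domain R"
    and finite_P: "finite P"
    and P_atoms: "P \<subseteq> atoms R"
    and P_repr: "a \<in> atoms R \<Longrightarrow> \<exists>p\<in>P. a \<sim> p"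
begin

lemma atom_closed: "p \<in> atoms R \<Longrightarrow> p \<in> carrier R"
  by (simp add: atoms_def nonzero_nonunits_def)

lemma atom_nonzero: "p \<in> atoms R \<Longrightarrow> p \<noteq> \<zero>"
  by (simp add: atoms_def nonzero_nonunits_def)

lemma P_closed: "p \<in> P \<Longrightarrow> p \<in> carrier R"
  using P_atoms atom_closed by blast

lemma pow_fun_closed: "(\<lambda>p. p [^] (e p :: nat)) \<in> P \<rightarrow> carrier R"
  using P_closed by auto

lemma finprod_pow_closed: "(\<Otimes>p\<in>P. p [^] (e p :: nat)) \<in> carrier R"
  using pow_fun_closed by (rule finprod_closed)

lemma finprod_pow_add:
  "(\<Otimes>p\<in>P. p [^] (e p + d p :: nat)) = (\<Otimes>p\<in>P. p [^] e p) \<otimes> (\<Otimes>p\<in>P. p [^] d p)"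
proof -
  have "(\<Otimes>p\<in>P. p [^] e p) \<otimes> (\<Otimes>p\<in>P. p [^] d p) = (\<Otimes>p\<in>P. p [^] e p \<otimes> p [^] d p)"
    using finprod_multf[OF pow_fun_closed pow_fun_closed] by simp
  also have "\<dots> = (\<Otimes>p\<in>P. p [^] (e p + d p))"
    using P_closed by (intro finprod_cong') (auto simp: nat_pow_mult)
  finally show ?thesis by simp
qed

text \<open>Each atom is traded for its associate in \<open>P\<close>, and the units that arise are
  collected in front.\<close>

lemma atom_list_factorization:
  assumes "set ps \<subseteq> atoms R"
  shows "\<exists>e. \<exists>u\<in>Units R. foldr (\<otimes>) ps \<one> = u \<otimes> (\<Otimes>p\<in>P. p [^] (e p :: nat))"
  using assms
proof (induction ps)
  case Nil
  have "(\<Otimes>p\<in>P. p [^] (0::nat)) = \<one>" by (simp add: finprod_one_eqI)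
  then show ?case
    by (intro exI[of _ "\<lambda>_. 0"] bexI[of _ \<one>]) auto
next
  case (Cons a ps)
  then obtain e u where eu: "u \<in> Units R"
      "foldr (\<otimes>) ps \<one> = u \<otimes> (\<Otimes>p\<in>P. p [^] (e p :: nat))"
    by auto
  obtain p where p: "p \<in> P" "a \<sim> p"
    using P_repr Cons.prems by auto
  obtain v where v: "v \<in> Units R" "a = v \<otimes> p"
    using p ring_associated_iff[of a p] atom_closed P_closed Cons.prems by auto
  \<comment> \<open>The factor \<open>p\<close> is written with the indicator exponent of
    \<open>p\<close>, so that multiplying by it adds exponent functions.\<close>
  have "(\<Otimes>q\<in>P. q [^] (if q = p then 1 else 0 :: nat)) = (\<Otimes>q\<in>P. if q = p then q else \<one>)"
    using P_closed by (intro finprod_cong') auto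
  also have "\<dots> = p"
    using finprod_singleton_swap[OF p(1) finite_P, of "\<lambda>q. q"] P_closed by auto
  finally have "(\<Otimes>q\<in>P. q [^] (e q + (if q = p then 1 else 0))) = (\<Otimes>q\<in>P. q [^] e q) \<otimes> p"
    using finprod_pow_add by simp
  then have "foldr (\<otimes>) (a # ps) \<one> = (v \<otimes> u) \<otimes> (\<Otimes>q\<in>P. q [^] (e q + (if q = p then 1 else 0)))"
    using eu v P_closed[OF p(1)] finprod_pow_closed[of e] Units_closed[of u] Units_closed[of v]
    by (simp add: m_ac)
  then show ?case
    using eu(1) v(1) by (intro exI[of _ "\<lambda>q. e q + (if q = p then 1 else 0)"]) blast
qed

lemma nonzero_factorization:
  assumes "x \<in> carrier R" "x \<noteq> \<zero>"
  shows "\<exists>e. \<exists>u\<in>Units R. x = u \<otimes> (\<Otimes>p\<in>P. p [^] (e p :: nat))"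
proof (cases "x \<in> Units R")
  case True
  have "(\<Otimes>p\<in>P. p [^] (0::nat)) = \<one>" by (simp add: finprod_one_eqI)
  then show ?thesis
    using True assms by (intro exI[of _ "\<lambda>_. 0"] bexI[of _ x]) auto
next
  case False
  then obtain ps where "set ps \<subseteq> atoms R" "foldr (\<otimes>) ps \<one> = x"
    using atomic assms by (auto simp: atomic_domain_def nonzero_nonunits_def)
  then show ?thesis using atom_list_factorization by metis
qed

lemma divides_in_sequence:
  fixes x :: "nat \<Rightarrow> 'a"
  assumes "\<And>k. x k \<in> carrier R" "\<And>k. x k \<noteq> \<zero>"
  shows "\<exists>k l. k < l \<and> x k divides x l"
proof -
  have "\<forall>k. \<exists>e. \<exists>u\<in>Units R. x k = u \<otimes> (\<Otimes>p\<in>P. p [^] (e p :: nat))"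
    using nonzero_factorization assms by blast
  then obtain e u where eu: "\<And>k. u k \<in> Units R"
      "\<And>k. x k = u k \<otimes> (\<Otimes>p\<in>P. p [^] (e k p :: nat))"
    by metis
  obtain f :: "nat \<Rightarrow> nat" where f: "strict_mono f" "\<forall>p\<in>P. mono (\<lambda>k. e (f k) p)"
    using dickson_subseq[OF finite_P] by blast
  \<comment> \<open>Any two successive terms of the monotone subsequence would do; the exponents of
    the first are bounded by those of the second.\<close>
  define k l where "k = f 0" and "l = f 1"
  have "k < l" using f(1) by (simp add: k_def l_def strict_mono_def)
  have le: "e k p \<le> e l p" if "p \<in> P" for p
    using f(2) that monoD[of "\<lambda>k. e (f k) p" 0 1] by (simp add: k_def l_def)
  let ?d = "\<lambda>p. e l p - e k p"
  have "(\<Otimes>p\<in>P. p [^] e l p) = (\<Otimes>p\<in>P. p [^] (e k p + ?d p))"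
    using P_closed le by (intro finprod_cong') auto
  also have "\<dots> = (\<Otimes>p\<in>P. p [^] e k p) \<otimes> (\<Otimes>p\<in>P. p [^] ?d p)"
    by (rule finprod_pow_add)
  finally have "x l = u l \<otimes> ((\<Otimes>p\<in>P. p [^] e k p) \<otimes> (\<Otimes>p\<in>P. p [^] ?d p))"
    using eu(2) by simp
  also have "\<dots> = x k \<otimes> (inv (u k) \<otimes> u l \<otimes> (\<Otimes>p\<in>P. p [^] ?d p))"
  proof -
    define A D v where "A = (\<Otimes>p\<in>P. p [^] e k p)" and "D = (\<Otimes>p\<in>P. p [^] ?d p)"
      and "v = inv (u k)"
    have c: "A \<in> carrier R" "D \<in> carrier R" "v \<in> carrier R" "u k \<in> carrier R" "u l \<in> carrier R"
      using finprod_pow_closed eu(1) by (auto simp: A_def D_def v_def)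
    have "u k \<otimes> A \<otimes> (v \<otimes> u l \<otimes> D) = (u k \<otimes> v) \<otimes> (u l \<otimes> (A \<otimes> D))"
      using c by (simp add: m_ac)
    also have "u k \<otimes> v = \<one>" using eu(1) by (simp add: v_def)
    finally show ?thesis using c eu(2)[of k] by (simp add: A_def D_def v_def)
  qed
  finally have "x k divides x l"
    using eu(1) finprod_pow_closed by (intro dividesI) (auto simp: Units_closed)
  then show ?thesis using \<open>k < l\<close> by blast
qed

section \<open>Powers of elements of the Jacobson radical\<close>

text \<open>
  The local form of the statement that nonzero prime ideals are maximal: some power of \<open>j\<close> is
  divisible by \<open>p\<close> in the localization at \<open>M\<close>. If \<open>p + j\<^sup>l = (p + j\<^sup>k) r\<close>, then
  \<open>p (1 - r) = j\<^sup>k (r - j\<^bsup>l-k\<^esup>)\<close>, and either \<open>r - j\<^bsup>l-k\<^esup>\<close> or \<open>1 - r\<close> lies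
  outside \<open>M\<close>. In the second case \<open>p\<close> is locally divisible by arbitrarily high powers of
  \<open>j\<close>, which Dickson's lemma excludes when applied to the cofactors.
\<close>
lemma locally_divides_pow:
  assumes M: "maximalideal M R" and j: "j \<in> M" and p: "p \<in> carrier R" "p \<noteq> \<zero>"
  shows "\<exists>(k::nat). \<exists>s\<in>carrier R - M. p divides s \<otimes> j [^] k"
proof (rule ccontr)
  assume "\<not> ?thesis"
  then have no: "\<not> p divides s \<otimes> j [^] k" if "s \<in> carrier R" "s \<notin> M" for s and k :: nat
    using that by blast
  interpret M: maximalideal M R by fact
  interpret MP: primeideal M R using maximalideal_prime[OF M] .
  have jc: "j \<in> carrier R" using j by auto
  have one: "\<one> \<notin> M" using M.one_imp_carrier M.I_notcarr by blast
  have "j \<noteq> \<zero>"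
    using no[of \<one> 1] one p dividesI[of \<zero> R \<zero> p] by auto
  have jpow: "j [^] (k::nat) \<in> carrier R" "j [^] k \<noteq> \<zero>" for k
    using jc \<open>j \<noteq> \<zero>\<close> by (induction k) (auto simp: integral_iff)
  have jpow_M: "j [^] (k::nat) \<in> M" if "k > 0" for k
    using that j jpow by (cases k) (auto intro: M.I_l_closed)
  have split: "j [^] l = j [^] k \<otimes> j [^] (l - k)" if "k < l" for k l :: nat
    using that jc by (simp add: nat_pow_mult)
  have far: "\<exists>s\<in>carrier R - M. \<exists>k\<ge>K. j [^] (k::nat) divides s \<otimes> p" for K
  proof -
    \<comment> \<open>The shift by \<open>Suc K\<close> ensures that the exponent found below is at
      least \<open>K\<close>.\<close>
    define x where "x k = p \<oplus> j [^] (Suc K + k)" for k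
    have "x k \<noteq> \<zero>" for k
    proof
      assume "x k = \<zero>"
      then have "\<one> \<otimes> j [^] (Suc K + k) = p \<otimes> (\<ominus> \<one>)"
        using p(1) jpow(1)[of "Suc K + k"] unfolding x_def
        by (metis add.inv_comm l_one minus_equality r_minus r_one one_closed)
      then show False
        using no[of \<one> "Suc K + k"] one p(1) by (metis dividesI a_inv_closed one_closed)
    qed
    moreover have "x k \<in> carrier R" for k
      unfolding x_def using p(1) jpow(1) by (rule a_closed)
    ultimately obtain k' l' where "k' < l'" "x k' divides x l'"
      using divides_in_sequence[of x] by blast
    then obtain k l r where kl: "K \<le> k" "k < l" and r: "r \<in> carrier R"
        "p \<oplus> j [^] l = (p \<oplus> j [^] k) \<otimes> r"
      by (auto simp: x_def factor_def intro!: that[of "Suc K + k'" "Suc K + l'"])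
    define a b where "a = j [^] k" and "b = j [^] (l - k)"
    have ab: "a \<in> carrier R" "b \<in> carrier R" "b \<in> M"
      using jpow jpow_M kl by (auto simp: a_def b_def)
    have "p \<oplus> a \<otimes> b = (p \<oplus> a) \<otimes> r"
      using r split[OF kl(2)] by (simp add: a_def b_def)
    moreover have "p \<otimes> (\<one> \<ominus> r) = (p \<oplus> a \<otimes> b) \<ominus> a \<otimes> b \<ominus> p \<otimes> r"
      using ab r(1) p(1) by algebra
    ultimately have "p \<otimes> (\<one> \<ominus> r) = (p \<oplus> a) \<otimes> r \<ominus> a \<otimes> b \<ominus> p \<otimes> r"
      by simp
    also have "\<dots> = a \<otimes> (r \<ominus> b)"
      using ab r(1) p(1) by algebra
    finally have eq: "p \<otimes> (\<one> \<ominus> r) = a \<otimes> (r \<ominus> b)" .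
    \<comment> \<open>If \<open>r\<close> were outside \<open>M\<close>, then so would be
      \<open>r \<ominus> b\<close>, as \<open>b\<close> lies in \<open>M\<close>; it would then be a
      forbidden multiplier \<open>s\<close> for \<open>j [^] k\<close>.\<close>
    have "r \<in> M"
    proof (rule ccontr)
      assume "r \<notin> M"
      have "r = (r \<ominus> b) \<oplus> b"
        using ab r(1) by algebra
      then have "r \<ominus> b \<notin> M"
        using \<open>r \<notin> M\<close> ab M.a_closed by metis
      moreover have "p divides (r \<ominus> b) \<otimes> a"
        using eq ab r(1) p(1) by (intro dividesI[of "\<one> \<ominus> r"]) (auto simp: m_comm)
      ultimately show False
        using no[of "r \<ominus> b" k] ab r(1) by (simp add: a_def)
    qed
    have "\<one> = (\<one> \<ominus> r) \<oplus> r"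
      using r(1) by algebra
    then have "\<one> \<ominus> r \<notin> M"
      using \<open>r \<in> M\<close> one M.a_closed by metis
    moreover have "a divides (\<one> \<ominus> r) \<otimes> p"
      using eq ab r(1) p(1) by (intro dividesI[of "r \<ominus> b"]) (auto simp: m_comm)
    ultimately show ?thesis
      using kl(1) r(1) unfolding a_def by blast
  qed
  \<comment> \<open>The exponent from \<open>far\<close> is lowered to exactly \<open>K\<close>, the
    surplus power going into the cofactor \<open>t\<close>.\<close>
  have "\<exists>s t. s \<in> carrier R - M \<and> t \<in> carrier R \<and> s \<otimes> p = j [^] K \<otimes> t" for K :: nat
  proof -
    obtain s k c where *: "s \<in> carrier R - M" "k \<ge> K" "c \<in> carrier R" "s \<otimes> p = j [^] k \<otimes> c"
      using far[of K] unfolding factor_def by blast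
    have "j [^] k = j [^] K \<otimes> j [^] (k - K)"
      using *(2) jc by (simp add: nat_pow_mult)
    then show ?thesis
      using * jpow(1) m_assoc by (intro exI[of _ s] exI[of _ "j [^] (k - K) \<otimes> c"]) auto
  qed
  then obtain s t where st: "\<And>K. s K \<in> carrier R" "\<And>K. s K \<notin> M" "\<And>K. t K \<in> carrier R"
      "\<And>K. s K \<otimes> p = j [^] (K::nat) \<otimes> t K"
    by (metis DiffE)
  have t0: "t K \<noteq> \<zero>" for K
  proof
    assume "t K = \<zero>"
    then have "s K \<otimes> p = \<zero>" using st(4)[of K] jpow by simp
    then have "s K = \<zero>" using st(1) p integral by blast
    then show False using st(2)[of K] M.zero_closed by simp
  qed
  obtain K L r where KL: "K < L" "r \<in> carrier R" "t L = t K \<otimes> r"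
    using divides_in_sequence[of t] st(3) t0 by (auto simp: factor_def)
  define a b where "a = j [^] K" and "b = j [^] (L - K)"
  have ab: "a \<in> carrier R" "b \<in> carrier R" "b \<in> M" "a \<noteq> \<zero>"
    using jpow jpow_M KL by (auto simp: a_def b_def)
  note c = ab(1,2) KL(2) st(1)[of K] st(1)[of L] st(3)[of K] p(1)
  \<comment> \<open>Comparing the relations for \<open>K\<close> and \<open>L\<close> and cancelling
    \<open>a \<otimes> t K\<close> makes \<open>s L\<close> a multiple of \<open>b\<close>, which
    lies in \<open>M\<close>.\<close>
  have "(s K \<otimes> p) \<otimes> s L = (s L \<otimes> p) \<otimes> s K"
    using c by (simp add: m_ac)
  then have "(a \<otimes> t K) \<otimes> s L = (a \<otimes> b \<otimes> (t K \<otimes> r)) \<otimes> s K"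
    using st(4) KL(3) split[OF KL(1)] by (simp add: a_def b_def)
  also have "\<dots> = (a \<otimes> t K) \<otimes> (b \<otimes> (r \<otimes> s K))"
    using c by (simp add: m_ac)
  finally have "s L = b \<otimes> (r \<otimes> s K)"
    using c ab(4) t0[of K] m_lcancel[of "a \<otimes> t K"] by (simp add: integral_iff)
  then show False
    using st(2)[of L] ab(3) c M.I_r_closed by simp
qed

text \<open>The local multipliers \<open>s\<close> form an ideal \<open>I\<close>, the union over
  \<open>k\<close> of the colon ideals of \<open>p\<close> by \<open>j [^] k\<close>. By
  \<open>locally_divides_pow\<close> it lies in no maximal ideal, so it contains
  \<open>\<one>\<close>.\<close>

lemma jacobson_pow_divisible:
  assumes j: "j \<in> carrier R" "\<And>M. maximalideal M R \<Longrightarrow> j \<in> M"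
    and p: "p \<in> carrier R" "p \<noteq> \<zero>"
  shows "\<exists>k::nat. p divides j [^] k"
proof -
  define I where "I = {s \<in> carrier R. \<exists>k::nat. p divides s \<otimes> j [^] k}"
  have jpow: "j [^] (k::nat) \<in> carrier R" for k using j(1) by simp
  have "ideal I R"
  proof (intro idealI add.subgroupI)
    show "ring R" by (rule ring_axioms)
    show "I \<subseteq> carrier R" by (auto simp: I_def)
    have "p divides \<zero> \<otimes> j [^] (0::nat)"
      using p by (intro dividesI[of \<zero>]) auto
    then show "I \<noteq> {}"
      unfolding I_def by blast
  next
    fix s assume "s \<in> I"
    then obtain k c where "s \<in> carrier R" "c \<in> carrier R" "s \<otimes> j [^] (k::nat) = p \<otimes> c"
      by (auto simp: I_def factor_def)
    moreover from this have "(\<ominus> s) \<otimes> j [^] k = p \<otimes> (\<ominus> c)"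
      using p jpow by (simp add: l_minus r_minus)
    ultimately show "\<ominus> s \<in> I"
      by (auto simp: I_def factor_def)
  next
    fix s t assume "s \<in> I" "t \<in> I"
    then obtain k c l d where s: "s \<in> carrier R" "c \<in> carrier R" "s \<otimes> j [^] (k::nat) = p \<otimes> c"
        and t: "t \<in> carrier R" "d \<in> carrier R" "t \<otimes> j [^] (l::nat) = p \<otimes> d"
      by (auto simp: I_def factor_def)
    define a b where "a = j [^] k" and "b = j [^] l"
    have ab: "a \<in> carrier R" "b \<in> carrier R" using jpow by (auto simp: a_def b_def)
    have "(s \<oplus> t) \<otimes> j [^] (k + l) = (s \<oplus> t) \<otimes> (a \<otimes> b)"
      using j(1) by (simp add: a_def b_def nat_pow_mult)
    also have "\<dots> = (s \<otimes> a) \<otimes> b \<oplus> (t \<otimes> b) \<otimes> a"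
      using s(1) t(1) ab by algebra
    also have "\<dots> = (p \<otimes> c) \<otimes> b \<oplus> (p \<otimes> d) \<otimes> a"
      using s(3) t(3) by (simp add: a_def b_def)
    also have "\<dots> = p \<otimes> (c \<otimes> b \<oplus> d \<otimes> a)"
      using s(2) t(2) ab p(1) by algebra
    finally have "p divides (s \<oplus> t) \<otimes> j [^] (k + l)"
      using s(2) t(2) ab by (intro dividesI) auto
    then show "s \<oplus> t \<in> I"
      using s(1) t(1) by (auto simp: I_def)
  next
    fix s x assume "s \<in> I" and x: "x \<in> carrier R"
    then obtain k c where s: "s \<in> carrier R" "c \<in> carrier R" "s \<otimes> j [^] (k::nat) = p \<otimes> c"
      by (auto simp: I_def factor_def)
    have "(x \<otimes> s) \<otimes> j [^] k = x \<otimes> (s \<otimes> j [^] k)"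
      using s(1) x jpow m_assoc by blast
    also have "\<dots> = p \<otimes> (x \<otimes> c)"
      using s x p by (simp add: m_lcomm)
    finally have "p divides (x \<otimes> s) \<otimes> j [^] k"
      using s x by (intro dividesI) auto
    then show "x \<otimes> s \<in> I" "s \<otimes> x \<in> I"
      using s(1) x by (auto simp: I_def m_comm[of s x])
  qed
  have "I = carrier R"
  proof (rule ccontr)
    assume "I \<noteq> carrier R"
    then obtain M where M: "maximalideal M R" "I \<subseteq> M"
      using exists_maximalideal[OF \<open>ideal I R\<close>] by blast
    then obtain k s where "s \<in> carrier R - M" "p divides s \<otimes> j [^] (k::nat)"
      using locally_divides_pow[OF M(1) j(2)[OF M(1)] p] by blast
    then show False using M(2) by (auto simp: I_def)
  qed
  then have "\<one> \<in> I" by simp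
  then show ?thesis using jpow by (auto simp: I_def)
qed

section \<open>Each atom lies in only one maximal ideal\<close>

text \<open>Elements \<open>e\<close> of \<open>M\<close> and \<open>f\<close> of \<open>N\<close>
  with sum \<open>\<one>\<close> and product divisible by \<open>p\<close> give a factorization of
  \<open>p\<close> times a unit into an element of \<open>M\<close> and an element of
  \<open>N\<close>.\<close>

lemma atom_in_unique_maximalideal:
  assumes fin: "finite {M. maximalideal M R}" and p: "p \<in> atoms R"
    and M: "maximalideal M R" "p \<in> M" and N: "maximalideal N R" "p \<in> N"
  shows "M = N"
proof (rule ccontr)
  assume "M \<noteq> N"
  interpret M: maximalideal M R by fact
  interpret N: maximalideal N R by fact
  have pc: "p \<in> carrier R" "p \<noteq> \<zero>"
    using p atom_closed atom_nonzero by auto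
  obtain a b where a: "a \<in> M" and b: "b \<in> carrier R" "\<forall>K\<in>{M. maximalideal M R} - {M}. b \<in> K"
      and ab1: "a \<oplus> b = \<one>"
  proof -
    have "finite ({M. maximalideal M R} - {M})" using fin by simp
    from comaximal_maximalideals[OF M(1) this] show thesis using that by blast
  qed
  have ac: "a \<in> carrier R" using a by auto
  \<comment> \<open>The factor \<open>a\<close> takes care of \<open>M\<close> and \<open>b\<close>
    of all other maximal ideals, so the product is in the Jacobson radical.\<close>
  have jac: "a \<otimes> b \<in> K" if "maximalideal K R" for K
  proof -
    interpret K: maximalideal K R by fact
    show ?thesis
      using a b ac that M.I_r_closed K.I_l_closed by (cases "K = M") auto
  qed
  obtain k c where kc: "c \<in> carrier R" "(a \<otimes> b) [^] (k::nat) = p \<otimes> c"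
    using jacobson_pow_divisible[OF _ jac pc] ac b(1) by (auto simp: factor_def)
  have "a \<otimes> \<one> \<oplus> b \<otimes> \<one> = \<one>" using ab1 ac b(1) by simp
  then have "comaximal R a b"
    unfolding comaximal_def by blast
  \<comment> \<open>With exponent \<open>Suc k\<close>, the \<open>k\<close>-th powers supply the
    factor \<open>p\<close> of \<open>e \<otimes> f\<close>, and the spare factor
    \<open>a \<otimes> b\<close> puts the cofactor \<open>j\<close> into the Jacobson
    radical.\<close>
  then obtain u v where uv: "u \<in> carrier R" "v \<in> carrier R"
      "a [^] Suc k \<otimes> u \<oplus> b [^] Suc k \<otimes> v = \<one>"
    using comaximal_pow_pow[OF ac b(1), of "Suc k" "Suc k"] unfolding comaximal_def by blast
  define e f where "e = a [^] Suc k \<otimes> u" and "f = b [^] Suc k \<otimes> v"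
  have ef: "e \<in> M" "f \<in> N" "e \<oplus> f = \<one>"
    using a b N(1) \<open>M \<noteq> N\<close> ac uv M.I_l_closed[of a "a [^] k"] N.I_l_closed[of b "b [^] k"]
      M.I_r_closed N.I_r_closed by (auto simp: e_def f_def)
  have efc: "e \<in> carrier R" "f \<in> carrier R" using ef by auto
  define j where "j = c \<otimes> (a \<otimes> b) \<otimes> (u \<otimes> v)"
  have jM: "j \<in> K" if "maximalideal K R" for K
  proof -
    interpret K: maximalideal K R by fact
    show ?thesis
      using jac[OF that] kc uv K.I_l_closed K.I_r_closed by (simp add: j_def)
  qed
  have jc: "j \<in> carrier R" using kc uv ac b by (simp add: j_def)
  have "e \<otimes> f = (a [^] k \<otimes> b [^] k) \<otimes> (a \<otimes> b) \<otimes> (u \<otimes> v)"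
    using ac b(1) uv(1,2) by (simp add: e_def f_def m_ac)
  also have "\<dots> = p \<otimes> j"
    using kc(1) ac b(1) uv(1,2) pc(1)
    by (simp add: nat_pow_distrib[symmetric] kc(2) j_def m_assoc)
  finally have efj: "e \<otimes> f = p \<otimes> j" .
  \<comment> \<open>This is the square of \<open>p \<ominus> \<one>\<close>, the coefficient of
    \<open>e \<otimes> f\<close> that remains in \<open>x \<otimes> y\<close> once \<open>p\<close>
    times the square of \<open>e \<oplus> f\<close> is split off.\<close>
  define z where "z = p \<otimes> p \<ominus> p \<ominus> p \<oplus> \<one>"
  define w where "w = \<one> \<oplus> j \<otimes> z"
  have zc: "z \<in> carrier R" using pc by (simp add: z_def)
  have wc: "w \<in> carrier R" using zc jc by (simp add: w_def)
  \<comment> \<open>Modulo every maximal ideal \<open>w\<close> is \<open>\<one>\<close>, since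
    \<open>j\<close> lies in all of them.\<close>
  have wU: "w \<in> Units R"
    unfolding Units_iff_notin_maximalideals[OF wc]
  proof (intro allI impI notI)
    fix K assume K: "maximalideal K R" "w \<in> K"
    interpret K: maximalideal K R by fact
    have "w \<ominus> j \<otimes> z \<in> K"
      using K.I_r_closed[OF jM[OF K(1)] zc] K(2) K.a_closed K.a_inv_closed by (simp add: minus_eq)
    moreover have "w \<ominus> j \<otimes> z = \<one>"
      using jc zc unfolding w_def by algebra
    ultimately show False
      using K.one_imp_carrier K.I_notcarr by simp
  qed
  \<comment> \<open>\<open>x\<close> is \<open>p\<close> modulo \<open>e\<close> and \<open>1\<close> modulo \<open>f\<close>, \<open>y\<close> the other way round, so \<open>p\<close> is
    locally associated to \<open>x \<otimes> y\<close> everywhere.\<close>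
  define x y where "x = p \<otimes> f \<oplus> e" and "y = p \<otimes> e \<oplus> f"
  have xM: "x \<in> M" and yN: "y \<in> N"
    using ef efc M(2) N(2) M.I_r_closed N.I_r_closed M.a_closed N.a_closed
    by (auto simp: x_def y_def)
  have xyc: "x \<in> carrier R" "y \<in> carrier R" using xM yN by auto
  have "x \<otimes> y = p \<otimes> ((e \<oplus> f) \<otimes> (e \<oplus> f)) \<oplus> (e \<otimes> f) \<otimes> z"
    using efc pc(1) unfolding x_def y_def z_def by algebra
  also have "\<dots> = p \<otimes> w"
    using ef(3) efj pc(1) jc zc by (simp add: w_def r_distr m_assoc)
  finally have xy: "x \<otimes> y = p \<otimes> w" .
  have "p = p \<otimes> (w \<otimes> inv w)" using wU pc(1) by simp
  also have "\<dots> = (p \<otimes> w) \<otimes> inv w" using wU pc(1) wc m_assoc by simp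
  also have "\<dots> = x \<otimes> (y \<otimes> inv w)" using wU xyc xy[symmetric] m_assoc by simp
  finally have "x \<in> Units R \<or> y \<otimes> inv w \<in> Units R"
    using p xyc wU by (auto simp: atoms_def)
  moreover have "y \<otimes> inv w \<in> N"
    using yN wU N.I_r_closed by simp
  ultimately show False
    using xM M(1) N(1) xyc wU Units_iff_notin_maximalideals by auto
qed

section \<open>Atoms inside a given maximal ideal\<close>

text \<open>As \<open>M\<close> is prime, some factor in an atomic factorization of \<open>x\<close>
  lies in \<open>M\<close>, and with it its associate in \<open>P\<close>.\<close>

lemma maximalideal_divisor:
  assumes M: "maximalideal M R" and x: "x \<in> M" "x \<noteq> \<zero>"
  shows "\<exists>p\<in>P \<inter> M. p divides x"
proof -
  interpret M: maximalideal M R by fact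
  interpret MP: primeideal M R using maximalideal_prime[OF M] .
  have one: "\<one> \<notin> M" using M.one_imp_carrier M.I_notcarr by blast
  have xc: "x \<in> carrier R" using x by auto
  have "x \<notin> Units R"
    using M x Units_iff_notin_maximalideals[OF xc] by blast
  then obtain ps where ps: "set ps \<subseteq> atoms R" "foldr (\<otimes>) ps \<one> = x"
    using atomic x(2) xc unfolding atomic_domain_def nonzero_nonunits_def by blast
  have "\<exists>a\<in>set ps. a \<in> M \<and> a divides foldr (\<otimes>) ps \<one>"
    if "set ps \<subseteq> atoms R" "foldr (\<otimes>) ps \<one> \<in> M" for ps
    using that
  proof (induction ps)
    case Nil
    then show ?case using one by simp
  next
    case (Cons a ps)
    have c: "a \<in> carrier R" "foldr (\<otimes>) ps \<one> \<in> carrier R"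
      using Cons.prems(1) atom_closed by (auto intro!: multlist_closed)
    show ?case
    proof (cases "a \<in> M")
      case True
      then show ?thesis using c by auto
    next
      case False
      then have "foldr (\<otimes>) ps \<one> \<in> M"
        using MP.I_prime c Cons.prems(2) by auto
      then obtain b where "b \<in> set ps" "b \<in> M" "b divides foldr (\<otimes>) ps \<one>"
        using Cons by auto
      then show ?thesis
        using c by (auto intro!: divides_prod_l)
    qed
  qed
  then obtain a where a: "a \<in> atoms R" "a \<in> M" "a divides x"
    using ps x(1) by blast
  obtain p where p: "p \<in> P" "a \<sim> p" using P_repr a(1) by blast
  have "p \<in> M"
    using p a(2) M.I_r_closed by (auto simp: associated_def factor_def)
  moreover have "p divides x"
    using p a(3) P_closed xc atom_closed[OF a(1)] divides_trans[of p a x]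
    by (auto simp: associated_def)
  ultimately show ?thesis using p(1) by blast
qed

lemma card_atoms_in_maximalideal:
  assumes M: "maximalideal M R" "M \<noteq> {\<zero>}"
    and no_prime: "prime_elements R = {}"
    and inj: "\<And>p q. p \<in> P \<Longrightarrow> q \<in> P \<Longrightarrow> p \<sim> q \<Longrightarrow> p = q"
  shows "card (P \<inter> M) \<ge> 3"
proof -
  interpret M: maximalideal M R by fact
  interpret MP: primeideal M R using maximalideal_prime[OF M(1)] .
  have fin: "finite (P \<inter> M)" using finite_P by simp
  obtain x where "x \<in> M" "x \<noteq> \<zero>" using M(2) M.zero_closed by blast
  then obtain p where p: "p \<in> P \<inter> M" using maximalideal_divisor M(1) by blast
  have pc: "p \<in> carrier R" "p \<noteq> \<zero>" "p \<notin> Units R"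
    using p P_atoms by (auto simp: atoms_def nonzero_nonunits_def)
  have "\<exists>q\<in>P \<inter> M. q \<noteq> p"
  proof (rule ccontr)
    assume "\<not> ?thesis"
    \<comment> \<open>With \<open>p\<close> as the only candidate divisor, \<open>M\<close> is the
      principal ideal of \<open>p\<close>; primality of \<open>M\<close> then passes to
      \<open>p\<close>.\<close>
    then have div: "p divides x" if "x \<in> M" for x
      using maximalideal_divisor[OF M(1) that] pc(1) dividesI[of \<zero> R \<zero> p]
      by (cases "x = \<zero>") auto
    have "prime R p"
    proof (rule primeI)
      fix a b assume ab: "a \<in> carrier R" "b \<in> carrier R" "p divides a \<otimes> b"
      then have "a \<otimes> b \<in> M"
        using p M.I_r_closed by (auto simp: factor_def)
      then show "p divides a \<or> p divides b"
        using MP.I_prime ab div by blast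
    qed (rule pc(3))
    then have "p \<in> prime_elements R"
      using prime_elements_eq pc ring_primeI by blast
    then show False using no_prime by simp
  qed
  then obtain q where q: "q \<in> P \<inter> M" "q \<noteq> p" by blast
  \<comment> \<open>Between atoms, divisibility forces the cofactor to be a unit, hence association,
    which \<open>inj\<close> excludes for distinct representatives.\<close>
  have no_div: "\<not> r divides s" if "r \<in> P" "s \<in> P" "r \<noteq> s" for r s
  proof
    assume "r divides s"
    then obtain c where c: "c \<in> carrier R" "s = r \<otimes> c" by (auto simp: factor_def)
    then have "r \<in> Units R \<or> c \<in> Units R"
      using that(2) P_atoms P_closed[OF that(1)] by (auto simp: atoms_def)
    moreover have "r \<notin> Units R"
      using that(1) P_atoms by (auto simp: atoms_def nonzero_nonunits_def)
    ultimately have "s \<sim> r"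
      using c ring_associated_iff[of s r] P_closed that m_comm by blast
    then show False using inj that by blast
  qed
  have qc: "q \<in> carrier R" using q P_closed by blast
  have "p \<oplus> q \<noteq> \<zero>"
  proof
    assume "p \<oplus> q = \<zero>"
    then have "q = p \<otimes> (\<ominus> \<one>)"
      using pc(1) qc by (metis a_comm minus_equality minus_minus one_closed r_minus r_one)
    then show False
      using no_div[of p q] p q by (auto simp: factor_def)
  qed
  moreover have "p \<oplus> q \<in> M" using p q M.a_closed by blast
  \<comment> \<open>This \<open>r\<close> is the third atom: were it \<open>p\<close> or
    \<open>q\<close>, it would divide the other one as well.\<close>
  ultimately obtain r where r: "r \<in> P \<inter> M" "r divides (p \<oplus> q)"
    using maximalideal_divisor[OF M(1)] by blast
  obtain c where c: "c \<in> carrier R" "p \<oplus> q = r \<otimes> c"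
    using r(2) by (auto simp: factor_def)
  have "r \<noteq> p"
  proof
    assume "r = p"
    have "q = (p \<oplus> q) \<ominus> p" using pc(1) qc by algebra
    also have "\<dots> = p \<otimes> (c \<ominus> \<one>)"
      using c pc(1) \<open>r = p\<close> by (simp add: minus_eq r_distr r_minus)
    finally show False
      using no_div[of p q] p q c(1) by (auto simp: factor_def)
  qed
  moreover have "r \<noteq> q"
  proof
    assume "r = q"
    have "p = (p \<oplus> q) \<ominus> q" using pc(1) qc by algebra
    also have "\<dots> = q \<otimes> (c \<ominus> \<one>)"
      using c qc \<open>r = q\<close> by (simp add: minus_eq r_distr r_minus)
    finally show False
      using no_div[of q p] p q c(1) by (auto simp: factor_def)
  qed
  ultimately have "card {p, q, r} = 3" using q(2) by auto
  moreover have "{p, q, r} \<subseteq> P \<inter> M" using p q r by blast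
  ultimately show ?thesis using card_mono[OF fin] by metis
qed

end

section \<open>Counting atoms over the maximal ideals\<close>

theorem theorem1p5:
  fixes R :: "('a, 'b) ring_scheme" and m n :: nat
  assumes "m > 0" and "n > 0"
    and "CK_domain n m R"
    and "primefree R"
  shows "real m \<le> real n / 3"
proof -
  have atomic: "atomic_domain R" and max: "finite {M. maximalideal M R}"
      "card {M. maximalideal M R} = m"
    using assms(3) by (auto simp: CK_domain_def has_n_maximal_ideals_def)
  obtain P where P: "P \<subseteq> atoms R" "finite P" "card P = n"
      "\<forall>a\<in>atoms R. \<exists>!p. p \<in> P \<and> a \<sim>\<^bsub>R\<^esub> p"
    using assms(3) by (auto simp: CK_domain_def has_n_atoms_def)
  interpret finite_atomic_domain R P
  proof -
    interpret domain R using atomic by (simp add: atomic_domain_def)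
    show "finite_atomic_domain R P"
      using atomic P by unfold_locales blast+
  qed
  have inj: "p = q" if pq: "p \<in> P" "q \<in> P" "p \<sim>\<^bsub>R\<^esub> q" for p q
  proof -
    have "\<exists>!r. r \<in> P \<and> p \<sim>\<^bsub>R\<^esub> r" using P(1,4) pq(1) by blast
    then show ?thesis using pq associated_refl[OF P_closed[OF pq(1)]] by blast
  qed
  have "P \<noteq> {}" using P(3) assms(2) by auto
  then obtain p where p: "p \<in> P" by blast
  \<comment> \<open>A maximal zero ideal would make \<open>R\<close> a field, where the atom
    \<open>p\<close> could not be a nonunit; that \<open>p\<close> exists comes from
    \<open>n > 0\<close>.\<close>
  have nonzero: "M \<noteq> {\<zero>\<^bsub>R\<^esub>}" if M: "maximalideal M R" for M
  proof
    assume "M = {\<zero>\<^bsub>R\<^esub>}"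
    then have "field R" using M zeromaximalideal_eq_field by simp
    then have "Units R = carrier R - {\<zero>\<^bsub>R\<^esub>}" by (rule field.field_Units)
    then show False
      using p P(1) by (auto simp: atoms_def nonzero_nonunits_def)
  qed
  have "3 * m = (\<Sum>M | maximalideal M R. 3)" using max by simp
  also have "\<dots> \<le> (\<Sum>M | maximalideal M R. card (P \<inter> M))"
    using card_atoms_in_maximalideal nonzero inj assms(4)
    by (intro sum_mono) (auto simp: primefree_def)
  \<comment> \<open>The sets \<open>P \<inter> M\<close> are pairwise disjoint because no atom lies
    in two maximal ideals.\<close>
  also have "\<dots> = card (\<Union>M\<in>{M. maximalideal M R}. P \<inter> M)"
    using max(1) P(1,2) atom_in_unique_maximalideal[OF max(1)]
    by (intro card_UN_disjoint[symmetric]) blast+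
  also have "\<dots> \<le> card P"
    using P(2) by (intro card_mono) auto
  finally have "3 * m \<le> n" using P(3) by simp
  then show ?thesis by linarith
qed

end
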